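(* For the sequence of functions $k_n:[0,1]\to(0,\infty)$, $n\in\mathbb{N}$, $n\ge 1$, defined by $$k_n(x)=\begin{cases}n^\alpha & 0\le x<\frac1n\\ 1&\frac1n\le x\le1,\end{cases}$$ where $\alpha>0$, there exist $p_n,q_n\in[0,1]^2$ and a sequence $C_n\to\infty$ so that $$d_{k_n}(p_n,q_n)\ge C_n\,d(p_n,q_n).$$
   Context: For a bounded, measurable $f:[0,1]\to(0,\infty)$ and a piecewise smooth curve $\gamma:[0,1]\to[0,1]^2$, $\gamma(t)=(x(t),y(t))$, put $L_f(\gamma)=\int_0^1\sqrt{x'(t)^2+f(x(t))^2y'(t)^2}\,dt$ and, for $p,q\in[0,1]^2$, $$d_f(p,q)=\inf\{L_f(\gamma):\gamma\text{ piecewise smooth},\ \gamma(0)=p,\ \gamma(1)=q\}.$$ Here $d$ denotes the Euclidean distance on $[0,1]^2$. *)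

theory Defs
  imports "HOL-Analysis.Analysis"
begin

abbreviation unit_square :: "(real \<times> real) set" where
  "unit_square \<equiv> {0..1} \<times> {0..1}"

(* Smooth means C^infinity on the closed interval, with one-sided derivatives at the
   endpoints: D k is the k-th derivative. In particular the derivative is bounded. *)
definition smooth_curve_on :: "real \<Rightarrow> real \<Rightarrow> (real \<Rightarrow> real \<times> real) \<Rightarrow> bool" where
  "smooth_curve_on a b \<gamma> \<longleftrightarrow>
     (\<exists>D :: nat \<Rightarrow> real \<Rightarrow> real \<times> real.
        (\<forall>t\<in>{a..b}. D 0 t = \<gamma> t) \<and>
        (\<forall>k. \<forall>t\<in>{a..b}. (D k has_vector_derivative D (Suc k) t) (at t within {a..b})))"

(* The library's valid_path is not used here: piecewise_C1_differentiable_on puts no condition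
   on the derivative near a breakpoint, so it admits curves of infinite length, for which the
   Henstock-Kurzweil integral in warped_length would have the junk value 0.
   Continuity at the breakpoints follows because neighbouring pieces are closed intervals. *)
definition piecewise_smooth :: "(real \<Rightarrow> real \<times> real) \<Rightarrow> bool" where
  "piecewise_smooth \<gamma> \<longleftrightarrow>
     (\<exists>(N::nat) (s :: nat \<Rightarrow> real). s 0 = 0 \<and> s N = 1 \<and>
        (\<forall>i<N. s i < s (Suc i) \<and> smooth_curve_on (s i) (s (Suc i)) \<gamma>))"

(* At the endpoints and the finitely many breakpoints deriv may be unspecified; this does not
   affect the integral. Values of the curve outside {0..1} are irrelevant. *)
definition warped_length :: "(real \<Rightarrow> real) \<Rightarrow> (real \<Rightarrow> real \<times> real) \<Rightarrow> real" where
  "warped_length f \<gamma> =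
     integral {0..1} (\<lambda>t. sqrt ((deriv (\<lambda>s. fst (\<gamma> s)) t)\<^sup>2
                              + (f (fst (\<gamma> t)))\<^sup>2 * (deriv (\<lambda>s. snd (\<gamma> s)) t)\<^sup>2))"

(* Intended for p, q in the unit square and f bounded, Borel measurable and positive on {0..1};
   the infimum is then over a nonempty set of nonnegative reals. *)
definition warped_dist :: "(real \<Rightarrow> real) \<Rightarrow> real \<times> real \<Rightarrow> real \<times> real \<Rightarrow> real" where
  "warped_dist f p q =
     Inf {warped_length f \<gamma> | \<gamma>.
            piecewise_smooth \<gamma> \<and> \<gamma> ` {0..1} \<subseteq> unit_square \<and> \<gamma> 0 = p \<and> \<gamma> 1 = q}"

definition warp_k :: "real \<Rightarrow> nat \<Rightarrow> real \<Rightarrow> real" where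
  "warp_k \<alpha> n x = (if 0 \<le> x \<and> x < 1 / real n then real n powr \<alpha> else 1)"

end

theory Submission
  imports Defs
begin

text \<open>
  The function \<open>k\<^sub>n\<close> makes vertical motion in the strip \<open>0 \<le> x < 1/n\<close> expensive, by the factor
  \<open>n\<^sup>\<alpha>\<close>, and horizontal motion always costs its Euclidean length. Take two points on the left
  edge at height difference \<open>\<delta>\<close>. A curve joining them either stays in the strip, and then has
  length at least \<open>n\<^sup>\<alpha> \<delta>\<close>, or leaves it, and then already its horizontal motion has length at
  least \<open>1/n\<close>. The choice \<open>\<delta> = n\<^sup>-\<^sup>\<alpha> / n\<close> balances the two bounds, so that the warped distance is
  at least \<open>1/n = n\<^sup>\<alpha> \<delta>\<close>; hence \<open>C\<^sub>n = n\<^sup>\<alpha>\<close> works.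

  Both bounds integrate a pointwise inequality between the derivative of a coordinate and the
  length integrand (\<open>warped_length_ge_increment\<close>). This needs the integrand to be
  integrable along every admissible curve (\<open>warped_speed_integrable\<close>), also when the curve
  crosses the line \<open>x = 1/n\<close> infinitely often; measurability and boundedness of the warping
  function suffice.
\<close>

section \<open>Regularity of piecewise smooth curves\<close>

text \<open>Induction on the number of pieces, stated without the subdivision so that continuity,
  differentiability and integrability can each be checked on one smooth piece.\<close>

lemma piecewise_smooth_glue:
  assumes "piecewise_smooth \<gamma>"
    and piece: "\<And>a b. a < b \<Longrightarrow> smooth_curve_on a b \<gamma> \<Longrightarrow> P a b"
    and glue: "\<And>a b c. a < b \<Longrightarrow> b < c \<Longrightarrow> P a b \<Longrightarrow> P b c \<Longrightarrow> P a c"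
  shows "P 0 (1::real)"
proof -
  obtain N s where s: "s 0 = (0::real)" "s N = 1"
    and sm: "\<And>i. i < N \<Longrightarrow> s i < s (Suc i) \<and> smooth_curve_on (s i) (s (Suc i)) \<gamma>"
    using assms(1) unfolding piecewise_smooth_def by blast
  have "s 0 < s (Suc i) \<and> P (s 0) (s (Suc i))" if "i < N" for i
    using that
  proof (induction i)
    case 0
    then show ?case using sm piece by blast
  next
    case (Suc i)
    then have "s 0 < s (Suc i)" "P (s 0) (s (Suc i))" by auto
    moreover have "s (Suc i) < s (Suc (Suc i))" "P (s (Suc i)) (s (Suc (Suc i)))"
      using sm[OF Suc.prems] piece by auto
    ultimately show ?case using glue by (meson less_trans)
  qed
  moreover have "N \<noteq> 0"
    using s by (metis zero_neq_one)
  ultimately show ?thesis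
    by (metis s lessI not0_implies_Suc)
qed

lemma smooth_curve_on_velocity:
  assumes "smooth_curve_on a b \<gamma>"
  obtains v where "continuous_on {a..b} \<gamma>" "continuous_on {a..b} v"
    "\<And>t. t \<in> {a<..<b} \<Longrightarrow> (\<gamma> has_vector_derivative v t) (at t)"
proof -
  obtain D where D0: "\<And>t. t \<in> {a..b} \<Longrightarrow> D 0 t = \<gamma> t"
    and D: "\<And>k t. t \<in> {a..b} \<Longrightarrow> (D k has_vector_derivative D (Suc k) t) (at t within {a..b})"
    using assms unfolding smooth_curve_on_def by blast
  have cont: "continuous_on {a..b} (D k)" for k
    by (rule continuous_on_vector_derivative[OF D])
  show ?thesis
  proof (rule that)
    show "continuous_on {a..b} \<gamma>"
      using cont[of 0] by (rule continuous_on_eq) (rule D0)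
    show "continuous_on {a..b} (D 1)"
      by (rule cont)
    fix t assume t: "t \<in> {a<..<b}"
    then have "(D 0 has_vector_derivative D 1 t) (at t)"
      using D[of t 0] by (simp add: at_within_Icc_at)
    then show "(\<gamma> has_vector_derivative D 1 t) (at t)"
      by (rule has_vector_derivative_transform_within_open[where S = "{a<..<b}"])
        (use t D0 in auto)
  qed
qed

lemma deriv_bounded_linear_compose:
  fixes \<phi> :: "'a::real_normed_vector \<Rightarrow> real"
  assumes "bounded_linear \<phi>" "(\<gamma> has_vector_derivative v) (at t)"
  shows "((\<lambda>s. \<phi> (\<gamma> s)) has_real_derivative \<phi> v) (at t)"
    and "deriv (\<lambda>s. \<phi> (\<gamma> s)) t = \<phi> v"
proof -
  show "((\<lambda>s. \<phi> (\<gamma> s)) has_real_derivative \<phi> v) (at t)"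
    using bounded_linear.has_vector_derivative[OF assms]
    by (simp add: has_real_derivative_iff_has_vector_derivative)
  then show "deriv (\<lambda>s. \<phi> (\<gamma> s)) t = \<phi> v"
    by (rule DERIV_imp_deriv)
qed

lemma piecewise_smooth_regularity:
  assumes "piecewise_smooth \<gamma>"
  obtains S where "finite S" "continuous_on {0..1} \<gamma>"
    "\<And>t. t \<in> {0<..<1} - S \<Longrightarrow> \<exists>v. (\<gamma> has_vector_derivative v) (at t)"
proof -
  let ?P = "\<lambda>a b. continuous_on {a..b} \<gamma> \<and>
    (\<exists>S. finite S \<and> (\<forall>t\<in>{a<..<b} - S. \<exists>v. (\<gamma> has_vector_derivative v) (at t)))"
  have "?P 0 1"
  proof (rule piecewise_smooth_glue[OF assms])
    fix a b :: real assume "smooth_curve_on a b \<gamma>"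
    then show "?P a b"
      by (rule smooth_curve_on_velocity) (meson DiffD1 finite.emptyI)
  next
    fix a b c :: real assume "a < b" "b < c" and 1: "?P a b" and 2: "?P b c"
    then have un: "{a..c} = {a..b} \<union> {b..c}" by auto
    have "continuous_on {a..c} \<gamma>"
      unfolding un using 1 2 by (intro continuous_on_closed_Un) auto
    moreover obtain S T where
      "finite S" "\<forall>t\<in>{a<..<b} - S. \<exists>v. (\<gamma> has_vector_derivative v) (at t)"
      "finite T" "\<forall>t\<in>{b<..<c} - T. \<exists>v. (\<gamma> has_vector_derivative v) (at t)"
      using 1 2 by blast
    then have "finite (insert b (S \<union> T))"
      "\<forall>t\<in>{a<..<c} - insert b (S \<union> T). \<exists>v. (\<gamma> has_vector_derivative v) (at t)"
      by (auto simp: not_less_iff_gr_or_eq) (metis Diff_iff greaterThanLessThan_iff linorder_neqE)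
    ultimately show "?P a c" by blast
  qed
  then show ?thesis using that by blast
qed

section \<open>The length integrand\<close>

abbreviation warped_speed :: "(real \<Rightarrow> real) \<Rightarrow> (real \<Rightarrow> real \<times> real) \<Rightarrow> real \<Rightarrow> real" where
  "warped_speed f \<gamma> t \<equiv> sqrt ((deriv (\<lambda>s. fst (\<gamma> s)) t)\<^sup>2
                              + (f (fst (\<gamma> t)))\<^sup>2 * (deriv (\<lambda>s. snd (\<gamma> s)) t)\<^sup>2)"

text \<open>The integral defining the length is only meaningful, and monotone, for an integrable
  integrand. On a smooth piece the integrand is, up to the endpoints, a measurable function that
  is bounded because the velocity is continuous on the closed interval.\<close>

lemma warped_speed_integrable:
  assumes \<gamma>: "piecewise_smooth \<gamma>"
    and f: "f \<in> borel_measurable borel" and B: "\<And>x. \<bar>f x\<bar> \<le> B"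
  shows "warped_speed f \<gamma> integrable_on {0..1}"
proof (rule piecewise_smooth_glue[OF \<gamma>])
  fix a b :: real assume "smooth_curve_on a b \<gamma>"
  then obtain v where c: "continuous_on {a..b} \<gamma>" and v: "continuous_on {a..b} v"
    and d: "\<And>t. t \<in> {a<..<b} \<Longrightarrow> (\<gamma> has_vector_derivative v t) (at t)"
    using smooth_curve_on_velocity by blast
  let ?g = "\<lambda>t. sqrt ((fst (v t))\<^sup>2 + (f (fst (\<gamma> t)))\<^sup>2 * (snd (v t))\<^sup>2)"
  let ?h = "\<lambda>t. sqrt ((fst (v t))\<^sup>2 + B\<^sup>2 * (snd (v t))\<^sup>2)"
  have "(\<lambda>t. fst (\<gamma> t)) \<in> borel_measurable (lebesgue_on {a..b})"
    by (intro continuous_imp_measurable_on_sets_lebesgue continuous_intros c) auto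
  then have [measurable]: "(\<lambda>t. f (fst (\<gamma> t))) \<in> borel_measurable (lebesgue_on {a..b})"
    using f by (rule measurable_compose)
  have [measurable]: "(\<lambda>t. fst (v t)) \<in> borel_measurable (lebesgue_on {a..b})"
    "(\<lambda>t. snd (v t)) \<in> borel_measurable (lebesgue_on {a..b})"
    by (intro continuous_imp_measurable_on_sets_lebesgue continuous_intros v; simp)+
  have "?g integrable_on {a..b}"
  proof (rule measurable_bounded_by_integrable_imp_integrable)
    show "?g \<in> borel_measurable (lebesgue_on {a..b})"
      by measurable
    show "?h integrable_on {a..b}"
      by (intro integrable_continuous_interval continuous_intros v)
    fix t
    have "(f (fst (\<gamma> t)))\<^sup>2 \<le> B\<^sup>2"
      using B[of "fst (\<gamma> t)"] by (metis abs_ge_zero power2_abs power_mono)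
    then show "norm (?g t) \<le> ?h t"
      by (auto intro!: mult_right_mono)
  qed auto
  then show "warped_speed f \<gamma> integrable_on {a..b}"
    by (rule integrable_spike_finite[where S = "{a,b}", rotated 2])
      (auto simp: deriv_bounded_linear_compose(2)[OF bounded_linear_fst d]
        deriv_bounded_linear_compose(2)[OF bounded_linear_snd d])
next
  fix a b c :: real assume "a < b" "b < c"
    and "warped_speed f \<gamma> integrable_on {a..b}" "warped_speed f \<gamma> integrable_on {b..c}"
  then show "warped_speed f \<gamma> integrable_on {a..c}"
    by (meson Henstock_Kurzweil_Integration.integrable_combine less_imp_le)
qed

text \<open>It is enough to integrate the pointwise bound up to time \<open>t\<close>, because the rest of the curve
  contributes a nonnegative length. Both the horizontal and the vertical estimate are instances,
  with \<open>\<phi>\<close> a coordinate.\<close>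

lemma warped_length_ge_increment:
  fixes \<phi> :: "real \<times> real \<Rightarrow> real"
  assumes \<gamma>: "piecewise_smooth \<gamma>"
    and f: "f \<in> borel_measurable borel" "\<And>x. \<bar>f x\<bar> \<le> B"
    and \<phi>: "bounded_linear \<phi>" and t: "t \<in> {0..1}"
    and dom: "\<And>s. s \<in> {0..1} \<Longrightarrow> c * deriv (\<lambda>s. \<phi> (\<gamma> s)) s \<le> warped_speed f \<gamma> s"
  shows "c * (\<phi> (\<gamma> t) - \<phi> (\<gamma> 0)) \<le> warped_length f \<gamma>"
proof -
  obtain S where S: "finite S" "continuous_on {0..1} \<gamma>"
    "\<And>t. t \<in> {0<..<1} - S \<Longrightarrow> \<exists>v. (\<gamma> has_vector_derivative v) (at t)"
    using piecewise_smooth_regularity[OF \<gamma>] by blast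
  have "(deriv (\<lambda>s. \<phi> (\<gamma> s)) has_integral \<phi> (\<gamma> t) - \<phi> (\<gamma> 0)) {0..t}"
  proof (rule fundamental_theorem_of_calculus_interior_strong[OF S(1)])
    show "continuous_on {0..t} (\<lambda>s. \<phi> (\<gamma> s))"
      using t by (intro bounded_linear.continuous_on[OF \<phi>] continuous_on_subset[OF S(2)]) auto
    fix s assume "s \<in> {0<..<t} - S"
    then obtain v where "(\<gamma> has_vector_derivative v) (at s)"
      using S(3)[of s] t by auto
    from deriv_bounded_linear_compose[OF \<phi> this]
    show "((\<lambda>s. \<phi> (\<gamma> s)) has_vector_derivative deriv (\<lambda>s. \<phi> (\<gamma> s)) s) (at s)"
      by (simp add: has_real_derivative_iff_has_vector_derivative)
  qed (use t in auto)
  then have inc: "((\<lambda>s. c * deriv (\<lambda>s. \<phi> (\<gamma> s)) s) has_integral c * (\<phi> (\<gamma> t) - \<phi> (\<gamma> 0))) {0..t}"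
    by (rule has_integral_mult_right)
  have int: "warped_speed f \<gamma> integrable_on {0..1}"
    by (rule warped_speed_integrable[OF \<gamma> f])
  then have int_t: "warped_speed f \<gamma> integrable_on {0..t}"
    by (rule integrable_on_subinterval) (use t in auto)
  have "c * (\<phi> (\<gamma> t) - \<phi> (\<gamma> 0)) \<le> integral {0..t} (warped_speed f \<gamma>)"
    by (rule has_integral_le[OF inc integrable_integral[OF int_t]]) (use t dom in auto)
  also have "\<dots> \<le> integral {0..1} (warped_speed f \<gamma>)"
    by (rule integral_subset_le[OF _ int_t int]) (use t in auto)
  finally show ?thesis
    by (simp add: warped_length_def)
qed

lemma warped_length_ge_horizontal:
  assumes "piecewise_smooth \<gamma>" "f \<in> borel_measurable borel" "\<And>x. \<bar>f x\<bar> \<le> B" "t \<in> {0..1}"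
  shows "fst (\<gamma> t) - fst (\<gamma> 0) \<le> warped_length f \<gamma>"
  using warped_length_ge_increment[OF assms(1-3) bounded_linear_fst assms(4), of 1]
  by (simp add: real_le_rsqrt)

lemma warped_length_ge_vertical:
  assumes "piecewise_smooth \<gamma>" "f \<in> borel_measurable borel" "\<And>x. \<bar>f x\<bar> \<le> B"
    and const: "\<And>t. t \<in> {0..1} \<Longrightarrow> f (fst (\<gamma> t)) = c"
  shows "c * (snd (\<gamma> 1) - snd (\<gamma> 0)) \<le> warped_length f \<gamma>"
  by (rule warped_length_ge_increment[OF assms(1-3) bounded_linear_snd])
    (auto simp: const power_mult_distrib intro!: real_le_rsqrt)

section \<open>Lower bounds for the distance\<close>

lemma piecewise_smooth_segment: "piecewise_smooth (\<lambda>t. p + t *\<^sub>R (q - p))"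
proof -
  let ?D = "\<lambda>k t. if k = 0 then p + t *\<^sub>R (q - p) else if k = 1 then q - p else 0"
  have "(?D k has_vector_derivative ?D (Suc k) t) (at t within {0..1})" for k :: nat and t
    by (cases k) (auto intro!: derivative_eq_intros)
  then have "smooth_curve_on 0 1 (\<lambda>t. p + t *\<^sub>R (q - p))"
    unfolding smooth_curve_on_def by (intro exI[of _ ?D]) simp
  then show ?thesis
    unfolding piecewise_smooth_def by (intro exI[of _ 1] exI[of _ real]) simp
qed

text \<open>The infimum of the empty set is unspecified, so a lower bound on all lengths bounds the
  distance only because some admissible curve, the segment, exists.\<close>

lemma warped_dist_geI:
  assumes p: "p \<in> unit_square" and q: "q \<in> unit_square"
    and "\<And>\<gamma>. piecewise_smooth \<gamma> \<Longrightarrow> \<gamma> ` {0..1} \<subseteq> unit_square \<Longrightarrow> \<gamma> 0 = p \<Longrightarrow> \<gamma> 1 = q \<Longrightarrow>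
           m \<le> warped_length f \<gamma>"
  shows "m \<le> warped_dist f p q"
proof -
  let ?\<sigma> = "\<lambda>t. p + t *\<^sub>R (q - p)"
  have "convex unit_square"
    by (intro convex_Times) auto
  then have "?\<sigma> t \<in> unit_square" if "t \<in> {0..1}" for t
    using convexD_alt[OF _ p q, of t] that by (simp add: algebra_simps)
  then have "?\<sigma> ` {0..1} \<subseteq> unit_square"
    by blast
  then have "warped_length f ?\<sigma> \<in> {warped_length f \<gamma> | \<gamma>.
      piecewise_smooth \<gamma> \<and> \<gamma> ` {0..1} \<subseteq> unit_square \<and> \<gamma> 0 = p \<and> \<gamma> 1 = q}"
    using piecewise_smooth_segment[of p q] by fastforce
  then show ?thesis
    unfolding warped_dist_def using assms(3) by (intro cInf_greatest) auto
qed

lemma warp_k_measurable: "warp_k \<alpha> n \<in> borel_measurable borel"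
  unfolding warp_k_def by measurable

lemma warp_k_bounded: "\<bar>warp_k \<alpha> n x\<bar> \<le> real n powr \<alpha> + 1"
  by (simp add: warp_k_def)

text \<open>To climb along the left edge, a curve either pays the factor \<open>n\<^sup>\<alpha>\<close> for its whole ascent
  or crosses the strip.\<close>

lemma warped_dist_warp_k_left_edge:
  assumes "0 \<le> \<delta>" "\<delta> \<le> 1"
  shows "min (1 / real n) (real n powr \<alpha> * \<delta>) \<le> warped_dist (warp_k \<alpha> n) (0, 0) (0, \<delta>)"
proof (rule warped_dist_geI)
  fix \<gamma> :: "real \<Rightarrow> real \<times> real"
  assume \<gamma>: "piecewise_smooth \<gamma>" "\<gamma> ` {0..1} \<subseteq> unit_square" "\<gamma> 0 = (0, 0)" "\<gamma> 1 = (0, \<delta>)"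
  note bounds = \<gamma>(1) warp_k_measurable warp_k_bounded
  show "min (1 / real n) (real n powr \<alpha> * \<delta>) \<le> warped_length (warp_k \<alpha> n) \<gamma>"
  proof (cases "\<exists>t\<in>{0..1}. 1 / real n \<le> fst (\<gamma> t)")
    case True
    then obtain t where t: "t \<in> {0..1}" "1 / real n \<le> fst (\<gamma> t)" by blast
    have "fst (\<gamma> t) - fst (\<gamma> 0) \<le> warped_length (warp_k \<alpha> n) \<gamma>"
      by (rule warped_length_ge_horizontal[OF bounds t(1)])
    with t(2) \<gamma>(3) show ?thesis by simp
  next
    case False
    have "warp_k \<alpha> n (fst (\<gamma> t)) = real n powr \<alpha>" if "t \<in> {0..1}" for t
    proof -
      have "\<gamma> t \<in> unit_square" using \<gamma>(2) that by blast
      with False that show ?thesis by (auto simp: warp_k_def mem_Times_iff not_le)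
    qed
    then have "real n powr \<alpha> * (snd (\<gamma> 1) - snd (\<gamma> 0)) \<le> warped_length (warp_k \<alpha> n) \<gamma>"
      by (rule warped_length_ge_vertical[OF bounds])
    with \<gamma>(3,4) show ?thesis by simp
  qed
qed (use assms in auto)

(* The points are required to be distinct: for p n = q n both sides vanish and the
   inequality would carry no information. The dist on real \<times> real is Euclidean. *)
theorem theorem3p5:
  fixes \<alpha> :: real
  assumes "\<alpha> > 0"
  shows "\<exists>(p :: nat \<Rightarrow> real \<times> real) (q :: nat \<Rightarrow> real \<times> real) (C :: nat \<Rightarrow> real).
           filterlim C at_top sequentially \<and>
           (\<forall>n\<ge>1. p n \<in> unit_square \<and> q n \<in> unit_square \<and> p n \<noteq> q n \<and>
                  warped_dist (warp_k \<alpha> n) (p n) (q n) \<ge> C n * dist (p n) (q n))"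
proof -
  define \<delta> where "\<delta> n = real n powr - \<alpha> / real n" for n
  have "filterlim (\<lambda>n. exp (\<alpha> * ln (real n))) at_top sequentially"
    by (intro filterlim_compose[OF exp_at_top] filterlim_compose[OF ln_at_top]
        filterlim_tendsto_pos_mult_at_top[OF tendsto_const assms] filterlim_real_sequentially)
  moreover have "eventually (\<lambda>n. exp (\<alpha> * ln (real n)) = real n powr \<alpha>) sequentially"
    using eventually_gt_at_top[of 0] by eventually_elim (simp add: powr_def)
  ultimately have "filterlim (\<lambda>n. real n powr \<alpha>) at_top sequentially"
    by (rule filterlim_mono_eventually[OF _ order_refl order_refl])
  moreover have "(0, 0) \<in> unit_square \<and> (0, \<delta> n) \<in> unit_square \<and> (0, 0) \<noteq> (0, \<delta> n) \<and>
      warped_dist (warp_k \<alpha> n) (0, 0) (0, \<delta> n) \<ge> real n powr \<alpha> * dist (0::real, 0) (0::real, \<delta> n)"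
    if n: "1 \<le> n" for n
  proof -
    have pos: "0 < \<delta> n"
      using n by (simp add: \<delta>_def)
    have "real n powr - \<alpha> \<le> 1"
      using n assms powr_mono[of "- \<alpha>" 0 "real n"] by simp
    then have le1: "\<delta> n \<le> 1"
      using n by (simp add: \<delta>_def divide_le_eq)
    have balance: "real n powr \<alpha> * \<delta> n = 1 / real n"
      using n by (simp add: \<delta>_def powr_minus)
    have "real n powr \<alpha> * \<delta> n \<le> warped_dist (warp_k \<alpha> n) (0, 0) (0, \<delta> n)"
      using warped_dist_warp_k_left_edge[of "\<delta> n" n \<alpha>] pos le1 balance by simp
    moreover have "dist (0::real, 0) (0::real, \<delta> n) = \<delta> n"
      using pos by (simp add: dist_Pair_Pair)
    ultimately show ?thesis
      using pos le1 by simp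
  qed
  ultimately show ?thesis
    by - (rule exI[of _ "\<lambda>_. (0, 0)"], rule exI[of _ "\<lambda>n. (0, \<delta> n)"],
        rule exI[of _ "\<lambda>n. real n powr \<alpha>"], simp)
qed

end
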